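(* For every integer $n \ge 1$, $R(Q_3, Q_n) \le \frac{37}{16}n + \frac{39}{16}$.
   Context: $Q_k$ denotes the Boolean lattice of dimension $k$: the family of all subsets of a $k$-element ground set (e.g. $[k]=\{1,\dots,k\}$), ordered by inclusion. A subposet $Q'$ of a poset $Q$ is a copy of a poset $P$ if there is a bijection $f$ from $P$ to $Q'$ such that $x \le y$ in $P$ if and only if $f(x) \le f(y)$ in $Q$. For posets $P, P'$, the poset Ramsey number $R(P,P')$ is the smallest integer $N$ such that for every coloring of the elements of $Q_N$ in red and blue, there is a copy of $P$ all of whose elements are red or a copy of $P'$ all of whose elements are blue. *)

theory Defs
  imports Complex_Main
begin

text \<open>
  A poset is given by its (reflexive) order relation \<open>P\<close>; its elements are \<open>Field P\<close>.
\<close>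

definition boolean_lattice :: "nat \<Rightarrow> nat set rel" where
  "boolean_lattice k = relation_of (\<subseteq>) (Pow {1..k})"

lemma Field_boolean_lattice: "Field (boolean_lattice k) = Pow {1..k}"
  unfolding boolean_lattice_def relation_of_def Field_def by blast

lemma Partial_order_boolean_lattice: "Partial_order (boolean_lattice k)"
  unfolding Field_boolean_lattice unfolding boolean_lattice_def
  by (rule partial_order_on_relation_ofI) auto

definition is_copy :: "'a rel \<Rightarrow> 'b rel \<Rightarrow> 'b set \<Rightarrow> bool" where
  "is_copy P Q S \<longleftrightarrow> S \<subseteq> Field Q \<and>
     (\<exists>f. bij_betw f (Field P) S \<and>
          (\<forall>x\<in>Field P. \<forall>y\<in>Field P. (x, y) \<in> P \<longleftrightarrow> (f x, f y) \<in> Q))"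

datatype colour = Red | Blue

text \<open>
  A colouring is a total function on \<open>nat set\<close>; only its values on the elements of
  \<open>boolean_lattice N\<close> matter, since copies lie inside that lattice. The value
  of \<open>LEAST\<close> is unspecified when no suitable \<open>N\<close> exists, so an upper bound on
  \<open>poset_Ramsey P P'\<close> cannot be obtained vacuously.
\<close>

definition poset_Ramsey :: "'a rel \<Rightarrow> 'b rel \<Rightarrow> nat" where
  "poset_Ramsey P P' =
     (LEAST N. \<forall>c :: nat set \<Rightarrow> colour.
        (\<exists>S. is_copy P (boolean_lattice N) S \<and> (\<forall>x\<in>S. c x = Red)) \<or>
        (\<exists>S. is_copy P' (boolean_lattice N) S \<and> (\<forall>x\<in>S. c x = Blue)))"

end

theory Submission
  imports Defs
begin

text \<open>
  Call a set bad for a colour if it has the other colour. Moving every set that lies above a bad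
  set up by one fixed set avoids all bad sets, unless a bad set sits below a moved bad set; so in
  the absence of a blue \<open>Q\<^sub>n\<close> nested red pairs are cheap to find. Let \<open>A \<subset> A1\<close> be a red
  pair with \<open>A1\<close> smallest, and let \<open>a \<in> A1 - A\<close>. Since the levels below \<open>A1\<close> carry no red pair, the
  same trick at the top gives a red pair \<open>C \<subset> B\<close> with \<open>A \<subseteq> C\<close>, \<open>A1 \<subseteq> B\<close>, \<open>a \<notin> C\<close> and
  \<open>card (C - A1) \<ge> n + 2\<close>, once the ground set has \<open>2 n + 3\<close> elements. Two more red pairs
  inside \<open>C - A1\<close>, marked by elements \<open>y\<close> and \<open>z\<close>, complete a red \<open>Q\<^sub>3\<close> with trace \<open>{a, y, z}\<close>.
  The bound \<open>2 n + 3\<close> is good enough for \<open>n \<ge> 2\<close>; for \<open>n = 1\<close> the blue sets form an antichain,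
  and the trick with the colours exchanged gives a red \<open>Q\<^sub>3\<close> in \<open>Q\<^sub>4\<close>.
\<close>

text \<open>Because \<open>f S \<inter> X = S\<close>, inclusion of images forces inclusion of
  arguments, so monotonicity alone makes \<open>f\<close> an order embedding. The elements of
  \<open>G - X\<close> stay free and are used for shifting.\<close>

definition trace_cube :: "'a set \<Rightarrow> 'a set \<Rightarrow> ('a set \<Rightarrow> bool) \<Rightarrow> bool" where
  "trace_cube G X P \<longleftrightarrow> (\<exists>f.
     (\<forall>S\<subseteq>X. f S \<subseteq> G \<and> f S \<inter> X = S \<and> P (f S)) \<and>
     (\<forall>S T. S \<subseteq> T \<and> T \<subseteq> X \<longrightarrow> f S \<subseteq> f T))"

lemma trace_cubeI:
  assumes "\<And>S. S \<subseteq> X \<Longrightarrow> f S \<subseteq> G" "\<And>S. S \<subseteq> X \<Longrightarrow> f S \<inter> X = S" "\<And>S. S \<subseteq> X \<Longrightarrow> P (f S)"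
    and "\<And>S T. S \<subseteq> T \<Longrightarrow> T \<subseteq> X \<Longrightarrow> f S \<subseteq> f T"
  shows "trace_cube G X P"
  unfolding trace_cube_def using assms by (intro exI[of _ f]) simp

lemma trace_cube_is_copy:
  assumes cube: "trace_cube {1..N} X P" and X: "finite X" "card X = k"
  shows "\<exists>S. is_copy (boolean_lattice k) (boolean_lattice N) S \<and> (\<forall>x\<in>S. P x)"
proof -
  from cube obtain f
    where f_all: "\<forall>S\<subseteq>X. f S \<subseteq> {1..N} \<and> f S \<inter> X = S \<and> P (f S)"
      and mono_all: "\<forall>S T. S \<subseteq> T \<and> T \<subseteq> X \<longrightarrow> f S \<subseteq> f T"
    unfolding trace_cube_def by (elim exE conjE)
  have f: "f S \<subseteq> {1..N} \<and> f S \<inter> X = S \<and> P (f S)" if "S \<subseteq> X" for S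
    using f_all that by simp
  have mono: "f S \<subseteq> f T" if "S \<subseteq> T" "T \<subseteq> X" for S T
    using mono_all that by simp
  obtain g where g: "bij_betw g {1..k} X"
    using X by (metis card_atLeastAtMost diff_Suc_1 finite_atLeastAtMost finite_same_card_bij)
  define h where "h S = f (g ` S)" for S
  have sub: "g ` S \<subseteq> X" if "S \<subseteq> {1..k}" for S
    using that g by (auto simp: bij_betw_def)
  have iff: "h S \<subseteq> h T \<longleftrightarrow> S \<subseteq> T" if ST: "S \<subseteq> {1..k}" "T \<subseteq> {1..k}" for S T
  proof
    assume "h S \<subseteq> h T"
    then have "g ` S \<subseteq> g ` T"
      unfolding h_def using f[OF sub[OF ST(1)]] f[OF sub[OF ST(2)]] by blast
    then show "S \<subseteq> T"
      using g ST by (auto simp: bij_betw_def dest: inj_onD)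
  next
    assume "S \<subseteq> T"
    then show "h S \<subseteq> h T"
      unfolding h_def using mono sub ST(2) by (meson image_mono)
  qed
  have hP: "h S \<subseteq> {1..N} \<and> P (h S)" if "S \<subseteq> {1..k}" for S
    unfolding h_def using f sub[OF that] by blast
  have "inj_on h (Pow {1..k})"
    by (rule inj_onI) (metis Pow_iff iff subset_antisym subset_refl)
  then have "bij_betw h (Pow {1..k}) (h ` Pow {1..k})"
    by (rule inj_on_imp_bij_betw)
  then have "is_copy (boolean_lattice k) (boolean_lattice N) (h ` Pow {1..k})"
    unfolding is_copy_def Field_boolean_lattice
    using hP iff
    by (intro conjI exI[of _ h])
      (simp_all add: boolean_lattice_def relation_of_def image_subset_iff)
  then show ?thesis
    using hP by blast
qed

lemma push_up:
  assumes AA: "A \<subseteq> A'" "A' \<inter> X = {}" "A' \<union> X \<subseteq> G" and no: "\<not> trace_cube G X P"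
  obtains S T where "S \<subseteq> T" "T \<subseteq> X" "\<not> P (A \<union> S)" "\<not> P (A' \<union> T)"
proof (rule ccontr)
  assume "\<not> thesis"
  with that have good: "P (A \<union> S) \<or> P (A' \<union> T)" if "S \<subseteq> T" "T \<subseteq> X" for S T
    using that by blast
  \<comment> \<open>The shifted region is closed upwards and \<open>A \<subseteq> A'\<close>, hence
    \<open>f\<close> is monotone. Where no shift happens, \<open>S' = S\<close> shows that
    \<open>A \<union> S\<close> is good.\<close>
  define f where "f S = (if \<exists>S'\<subseteq>S. \<not> P (A \<union> S') then A' \<union> S else A \<union> S)" for S
  have "trace_cube G X P"
  proof (rule trace_cubeI[where f = f])
    show "f S \<subseteq> G" "f S \<inter> X = S" if "S \<subseteq> X" for S
      using AA that unfolding f_def by auto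
    show "P (f S)" if "S \<subseteq> X" for S
      using good that unfolding f_def by auto
    show "f S \<subseteq> f T" if "S \<subseteq> T" "T \<subseteq> X" for S T
      using AA that unfolding f_def by (auto 0 3 dest: subset_trans)
  qed
  with no show False by blast
qed

text \<open>Traces are tested only at extreme members: \<open>a \<in> A1\<close> passes to every set
  above \<open>A1\<close>, and \<open>a \<notin> C\<close> to every set below \<open>C\<close>;
  likewise for \<open>y\<close> with \<open>A2\<close>, \<open>B13\<close> and for \<open>z\<close>
  with \<open>A3\<close>, \<open>B12\<close>.\<close>

lemma trace_cube_3:
  assumes G: "B \<subseteq> G" and ne: "a \<noteq> y" "a \<noteq> z" "y \<noteq> z"
    and P: "P A" "P A1" "P A2" "P A3" "P B12" "P B13" "P C" "P B"
    and le: "A \<subseteq> A1" "A \<subseteq> A2" "A \<subseteq> A3" "A1 \<subseteq> B12" "A2 \<subseteq> B12" "A1 \<subseteq> B13" "A3 \<subseteq> B13"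
      "A2 \<subseteq> C" "A3 \<subseteq> C" "B12 \<subseteq> B" "B13 \<subseteq> B" "C \<subseteq> B"
    and tr: "a \<in> A1" "y \<in> A2" "z \<in> A3" "z \<notin> B12" "y \<notin> B13" "a \<notin> C"
  shows "trace_cube G {a, y, z} P"
proof (rule trace_cubeI)
  let ?f = "\<lambda>S. if a \<in> S then if y \<in> S then if z \<in> S then B else B12
                            else if z \<in> S then B13 else A1
                else if y \<in> S then if z \<in> S then C else A2
                     else if z \<in> S then A3 else A"
  have "A \<subseteq> B" "A1 \<subseteq> B" "A2 \<subseteq> B" "A3 \<subseteq> B" using le by auto
  then show "?f S \<subseteq> G" for S
    using G le by auto
  show "?f S \<inter> {a, y, z} = S" if "S \<subseteq> {a, y, z}" for S
  proof -
    have "a \<in> ?f S \<longleftrightarrow> a \<in> S" "y \<in> ?f S \<longleftrightarrow> y \<in> S" "z \<in> ?f S \<longleftrightarrow> z \<in> S"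
      using le tr by auto
    then show ?thesis using that by blast
  qed
  show "P (?f S)" for S
    using P by simp
  show "?f S \<subseteq> ?f T" if "S \<subseteq> T" for S T
  proof -
    have "a \<in> S \<Longrightarrow> a \<in> T" "y \<in> S \<Longrightarrow> y \<in> T" "z \<in> S \<Longrightarrow> z \<in> T"
      using that by auto
    then show ?thesis using le by auto
  qed
qed

text \<open>Two shifts are glued. Small \<open>S\<close> move up by \<open>y\<close>, which cannot
  fail because of \<open>low\<close>. Large \<open>S\<close> start from
  \<open>S \<union> (G - X)\<close> and move down by \<open>a\<close> when a bad set lies above. As
  no cube arises, the upper shift must fail, and its failure is the pair sought.\<close>

lemma high_pair:
  assumes X: "X \<subseteq> G" "X \<inter> A1 = {}" "finite X" and A1: "a \<in> A1" "A1 \<subseteq> G" and y: "y \<in> G - X" "y \<noteq> a"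
    and low: "\<And>U V. U \<subset> V \<Longrightarrow> V \<subseteq> G \<Longrightarrow> card V < card A1 \<Longrightarrow> P U \<or> P V"
    and no: "\<not> trace_cube G X P"
  obtains S B where "S \<subseteq> X" "card A1 \<le> card S + 1" "S \<union> (G - X) \<subseteq> B" "B \<subseteq> G"
    "\<not> P B" "\<not> P (S \<union> (G - X) - {a})"
proof (rule ccontr)
  let ?Y = "G - X"
  assume "\<not> thesis"
  with that have high: "P B \<or> P (S \<union> ?Y - {a})"
    if "S \<subseteq> X" "card A1 \<le> card S + 1" "S \<union> ?Y \<subseteq> B" "B \<subseteq> G" for S B
    using that by blast
  \<comment> \<open>The threshold is the last one for which \<open>insert y S\<close> is still
    smaller than \<open>A1\<close>, as \<open>low\<close> demands. Since
    \<open>y \<noteq> a\<close>, removing \<open>a\<close> from the upper part keeps it above the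
    lower part.\<close>
  define f where "f S =
    (if card S + 1 < card A1 then if \<exists>U\<subseteq>S. \<not> P U then insert y S else S
     else if \<exists>B. S \<union> ?Y \<subseteq> B \<and> B \<subseteq> G \<and> \<not> P B then S \<union> ?Y - {a} else S \<union> ?Y)" for S
  have aX: "a \<notin> X" using X A1 by blast
  have "trace_cube G X P"
  proof (rule trace_cubeI[where f = f])
    show "f S \<subseteq> G" "f S \<inter> X = S" if "S \<subseteq> X" for S
      using X y aX that unfolding f_def by auto
    show "P (f S)" if S: "S \<subseteq> X" for S
    proof (cases "card S + 1 < card A1")
      case True
      have "P (insert y S)" if U: "U \<subseteq> S" "\<not> P U" for U
      proof -
        have "y \<notin> S" using S y by blast
        then have "U \<subset> insert y S" using U(1) by blast
        moreover have "card (insert y S) < card A1"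
          using True \<open>y \<notin> S\<close> S X(3) by (simp add: finite_subset)
        moreover have "insert y S \<subseteq> G" using S X y by blast
        ultimately show ?thesis using low U(2) by blast
      qed
      then show ?thesis using True unfolding f_def by auto
    next
      case False
      have "S \<union> ?Y \<subseteq> G" using S X by blast
      then show ?thesis using False high[OF S] unfolding f_def by auto
    qed
    show "f S \<subseteq> f T" if "S \<subseteq> T" "T \<subseteq> X" for S T
    proof -
      have "card S \<le> card T"
        using that X(3) by (meson card_mono finite_subset)
      then consider "card T + 1 < card A1" "card S + 1 < card A1"
        | "\<not> card T + 1 < card A1" "card S + 1 < card A1"
        | "\<not> card T + 1 < card A1" "\<not> card S + 1 < card A1" by linarith
      then show ?thesis
      proof cases
        case 1
        then show ?thesis using that unfolding f_def by auto
      next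
        case 2
        then have "f S \<subseteq> insert y S" "T \<union> ?Y - {a} \<subseteq> f T" unfolding f_def by auto
        then show ?thesis using that y aX by blast
      next
        case 3
        \<comment> \<open>A bad set above \<open>T \<union> ?Y\<close> is also above
          \<open>S \<union> ?Y\<close>, so whenever \<open>T\<close> is moved down, \<open>S\<close>
          is too.\<close>
        show ?thesis
        proof (cases "\<exists>B. T \<union> ?Y \<subseteq> B \<and> B \<subseteq> G \<and> \<not> P B")
          case True
          then have "\<exists>B. S \<union> ?Y \<subseteq> B \<and> B \<subseteq> G \<and> \<not> P B"
            using that(1) by (meson Un_mono order_refl order_trans)
          then show ?thesis using 3 True that(1) unfolding f_def by auto
        next
          case False
          then have "f T = T \<union> ?Y" using 3 unfolding f_def by argo
          moreover have "f S \<subseteq> S \<union> ?Y" using 3 unfolding f_def by auto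
          ultimately show ?thesis using that(1) by blast
        qed
      qed
    qed
  qed
  with no show False by blast
qed

lemma cube_3_or_cube_n:
  assumes G: "finite G" "card G = 2 * n + 3"
    and no: "\<And>X. X \<subseteq> G \<Longrightarrow> card X = n \<Longrightarrow> \<not> trace_cube G X P"
  shows "\<exists>X\<subseteq>G. card X = 3 \<and> trace_cube G X (\<lambda>S. \<not> P S)"
proof -
  define Q where "Q m \<longleftrightarrow> (\<exists>A A1. A \<subset> A1 \<and> A1 \<subseteq> G \<and> card A1 = m \<and> \<not> P A \<and> \<not> P A1)" for m
  obtain W where W: "W \<subseteq> G" "card W = n + 1"
    using obtain_subset_with_card_n[of "n + 1" G] G by auto
  then obtain w where w: "w \<in> W" by fastforce
  have cW: "card (W - {w}) = n" "finite W"
    using W w G by (auto simp: finite_subset)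
  \<comment> \<open>This first pair, found inside a set of size \<open>n + 1\<close>, bounds the
    size of the smallest one.\<close>
  obtain S T where ST: "S \<subseteq> T" "T \<subseteq> W - {w}" "\<not> P ({} \<union> S)" "\<not> P ({w} \<union> T)"
    by (rule push_up[of "{}" "{w}" "W - {w}" G P]) (use W w no[OF _ cW(1)] in auto)
  have cT: "card ({w} \<union> T) \<le> n + 1"
    using card_mono[of W "{w} \<union> T"] ST(2) w W cW by auto
  have "Q (card ({w} \<union> T))"
    unfolding Q_def using ST W w by (intro exI[of _ S] exI[of _ "{w} \<union> T"]) auto
  then have QL: "Q (LEAST m. Q m)" and "(LEAST m. Q m) \<le> n + 1"
    using cT by (auto intro: LeastI Least_le order_trans)
  then obtain A A1 where A: "A \<subset> A1" "A1 \<subseteq> G" "\<not> P A" "\<not> P A1" and cA: "card A1 \<le> n + 1"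
    and lst: "card A1 = (LEAST m. Q m)"
    unfolding Q_def by auto
  have low: "P U \<or> P V" if "U \<subset> V" "V \<subseteq> G" "card V < card A1" for U V
    using not_less_Least[of "card V" Q] that lst unfolding Q_def by auto
  obtain a where a: "a \<in> A1" "a \<notin> A" using A by blast
  have finA1: "finite A1" using A G finite_subset by blast
  have cGA: "card (G - A1) = 2 * n + 3 - card A1"
    using A finA1 G by (simp add: card_Diff_subset)
  then have "n \<le> card (G - A1)" using cA by linarith
  then obtain X where X: "X \<subseteq> G - A1" "card X = n"
    by (rule obtain_subset_with_card_n)
  have finX: "finite X" using X G by (meson Diff_subset finite_subset)
  let ?Y = "G - X"
  have cY: "card ?Y = n + 3"
    using X G finX by (subst card_Diff_subset) auto
  have "?Y - {a} \<noteq> {}"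
    using cY card_mono[of "{a}" ?Y] by auto
  then obtain y where "y \<in> ?Y" "y \<noteq> a" by blast
  then obtain S B where S: "S \<subseteq> X" "card A1 \<le> card S + 1" and B: "S \<union> ?Y \<subseteq> B" "B \<subseteq> G" "\<not> P B"
    and C: "\<not> P (S \<union> ?Y - {a})"
    using high_pair[of X G A1 a y P] X A a finX low no[of X] by blast
  define C where "C = S \<union> ?Y - {a}"
  have A1Y: "A1 \<subseteq> ?Y" using X A by blast
  \<comment> \<open>Removing \<open>a\<close> costs nothing here, since \<open>a \<in> A1\<close>.
    From \<open>card ?Y = n + 3\<close> and \<open>card A1 \<le> card S + 1\<close> at least
    \<open>n + 2\<close> elements remain: \<open>n\<close> for the next cube and two for the markers
    \<open>y\<close> and \<open>z\<close>. This is what determines the size \<open>2 * n + 3\<close>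
    of \<open>G\<close>.\<close>
  have "C - A1 = (S \<union> ?Y) - A1" unfolding C_def using a by blast
  moreover have "card ((S \<union> ?Y) - A1) = card S + card ?Y - card A1"
  proof -
    have "card (S \<union> ?Y) = card S + card ?Y"
      using S finX G by (intro card_Un_disjoint) (auto simp: finite_subset)
    then show ?thesis using A1Y finA1 by (subst card_Diff_subset) auto
  qed
  ultimately have "n + 2 \<le> card (C - A1)" using cY S by simp
  then obtain Z where Z: "Z \<subseteq> C - A1" "card Z = n + 2"
    using obtain_subset_with_card_n by metis
  then obtain y z X' where X': "Z = insert y (insert z X')" "y \<noteq> z" "y \<notin> X'" "z \<notin> X'" "card X' = n"
    by (auto simp: card_Suc_eq)
  have ZG: "Z \<subseteq> G" using Z B unfolding C_def by blast
  have AZ: "A1 \<inter> Z = {}" using Z by blast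
  \<comment> \<open>The marker \<open>u\<close> joins both sets, while the other marker lies outside
    \<open>A1\<close> and \<open>X'\<close> and so stays out of both. This keeps the traces on
    \<open>y\<close> and \<open>z\<close> apart.\<close>
  have pair: "\<exists>S T. S \<subseteq> T \<and> T \<subseteq> X' \<and> \<not> P (insert u A \<union> S) \<and> \<not> P (insert u A1 \<union> T)"
    if "u \<in> {y, z}" for u
  proof (rule push_up[of "insert u A" "insert u A1" X' G P])
    show "\<not> trace_cube G X' P" using no X' ZG by auto
    show "insert u A \<subseteq> insert u A1" using A by blast
    show "insert u A1 \<inter> X' = {}" "insert u A1 \<union> X' \<subseteq> G" using that X' AZ ZG A by auto
  qed blast
  obtain S2 T2 where 2: "S2 \<subseteq> T2" "T2 \<subseteq> X'" "\<not> P (insert y A \<union> S2)" "\<not> P (insert y A1 \<union> T2)"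
    using pair[of y] by auto
  obtain S3 T3 where 3: "S3 \<subseteq> T3" "T3 \<subseteq> X'" "\<not> P (insert z A \<union> S3)" "\<not> P (insert z A1 \<union> T3)"
    using pair[of z] by auto
  have AC: "A \<subseteq> C" using A A1Y a unfolding C_def by blast
  have ZC: "Z \<subseteq> C" using Z by blast
  have CB: "C \<subseteq> B" "A1 \<subseteq> B" using B A1Y unfolding C_def by auto
  have aC: "a \<notin> C" unfolding C_def by blast
  have "y \<in> C" "z \<in> C" "X' \<subseteq> C" "y \<notin> A1" "z \<notin> A1"
    using ZC AZ X'(1) by auto
  note yz = this
  have in_B: "insert y A1 \<union> T2 \<subseteq> B" "insert z A1 \<union> T3 \<subseteq> B"
    and in_C: "insert y A \<union> S2 \<subseteq> C" "insert z A \<union> S3 \<subseteq> C"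
    using yz CB AC 2(1,2) 3(1,2) by blast+
  have ne: "a \<noteq> y" "a \<noteq> z" using yz a(1) by auto
  have "trace_cube G {a, y, z} (\<lambda>S. \<not> P S)"
  proof (rule trace_cube_3)
    show "\<not> P A" "\<not> P A1" "\<not> P (insert y A \<union> S2)" "\<not> P (insert z A \<union> S3)"
      "\<not> P (insert y A1 \<union> T2)" "\<not> P (insert z A1 \<union> T3)" "\<not> P C" "\<not> P B"
      using A(3,4) 2(3,4) 3(3,4) C B(3) unfolding C_def by auto
    show "A \<subseteq> A1" "A \<subseteq> insert y A \<union> S2" "A \<subseteq> insert z A \<union> S3"
      "A1 \<subseteq> insert y A1 \<union> T2" "insert y A \<union> S2 \<subseteq> insert y A1 \<union> T2"
      "A1 \<subseteq> insert z A1 \<union> T3" "insert z A \<union> S3 \<subseteq> insert z A1 \<union> T3"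
      using A(1) 2(1) 3(1) by auto
    show "z \<notin> insert y A1 \<union> T2" "y \<notin> insert z A1 \<union> T3"
      using X'(2,3,4) yz 2(2) 3(2) by auto
  qed (use B(2) ne X'(2) in_B in_C CB(1) a(1) aC in simp_all)
  moreover have "card {a, y, z} = 3" "{a, y, z} \<subseteq> G"
    using ne X'(2) yz B(2) CB a(1) by auto
  ultimately show ?thesis by blast
qed

lemma poset_Ramsey_le:
  assumes "\<And>P. (\<exists>X\<subseteq>{1..N}. card X = k \<and> trace_cube {1..N} X (\<lambda>S. \<not> P S)) \<or>
                (\<exists>X\<subseteq>{1..N}. card X = n \<and> trace_cube {1..N} X P)"
  shows "poset_Ramsey (boolean_lattice k) (boolean_lattice n) \<le> N"
  unfolding poset_Ramsey_def
proof (rule Least_le, rule allI)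
  fix c :: "nat set \<Rightarrow> colour"
  have red: "c x \<noteq> Blue \<longleftrightarrow> c x = Red" for x by (cases "c x") auto
  show "(\<exists>S. is_copy (boolean_lattice k) (boolean_lattice N) S \<and> (\<forall>x\<in>S. c x = Red)) \<or>
        (\<exists>S. is_copy (boolean_lattice n) (boolean_lattice N) S \<and> (\<forall>x\<in>S. c x = Blue))"
    using assms[of "\<lambda>S. c S = Blue"] unfolding red
    by (meson finite_atLeastAtMost finite_subset trace_cube_is_copy)
qed

lemma poset_Ramsey_3: "poset_Ramsey (boolean_lattice 3) (boolean_lattice n) \<le> 2 * n + 3"
proof (rule poset_Ramsey_le, rule disjCI)
  let ?G = "{1..2 * n + 3}"
  fix P :: "nat set \<Rightarrow> bool"
  assume "\<not> (\<exists>X\<subseteq>?G. card X = n \<and> trace_cube ?G X P)"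
  then have no: "\<not> trace_cube ?G X P" if "X \<subseteq> ?G" "card X = n" for X
    using that by simp
  have "finite ?G" "card ?G = 2 * n + 3" by simp_all
  then show "\<exists>X\<subseteq>?G. card X = 3 \<and> trace_cube ?G X (\<lambda>S. \<not> P S)"
    using no by (rule cube_3_or_cube_n)
qed

lemma poset_Ramsey_1: "poset_Ramsey (boolean_lattice k) (boolean_lattice 1) \<le> k + 1"
proof (rule poset_Ramsey_le, rule disjCI)
  fix P :: "nat set \<Rightarrow> bool"
  assume no: "\<not> (\<exists>X\<subseteq>{1..k + 1}. card X = 1 \<and> trace_cube {1..k + 1} X P)"
  have "trace_cube {1..k + 1} {1..k} (\<lambda>S. \<not> P S)"
  proof (rule ccontr)
    assume "\<not> ?thesis"
    \<comment> \<open>Here red is the wanted colour, so the failure of \<open>push_up\<close>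
      delivers two nested blue sets, distinguished by \<open>k + 1\<close>: a blue chain of length
      two.\<close>
    then obtain S T where ST: "S \<subseteq> T" "T \<subseteq> {1..k}" "P S" "P (insert (k + 1) T)"
      by (rule push_up[of "{}" "{k + 1}", rotated 3]) auto
    have "trace_cube {1..k + 1} {k + 1} P"
      by (rule trace_cubeI[where f = "\<lambda>U. if U = {} then S else insert (k + 1) T"])
        (use ST in auto)
    with no show False by auto
  qed
  then show "\<exists>X\<subseteq>{1..k + 1}. card X = k \<and> trace_cube {1..k + 1} X (\<lambda>S. \<not> P S)"
    by (intro exI[of _ "{1..k}"]) auto
qed

theorem theorem6:
  fixes n :: nat
  assumes "n \<ge> 1"
  shows "real (poset_Ramsey (boolean_lattice 3) (boolean_lattice n))
           \<le> 37 / 16 * real n + 39 / 16"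
\<comment> \<open>\<open>2 * n + 3\<close> is within the bound exactly when
  \<open>n \<ge> 9 / 5\<close>. For \<open>n = 1\<close> the bound is 4.75, so 5 is too large and 4
  is required.\<close>
proof (cases "n = 1")
  case True
  then show ?thesis using poset_Ramsey_1[of 3] by simp
next
  case False
  then have "real n \<ge> 2" using assms by simp
  moreover have "real (poset_Ramsey (boolean_lattice 3) (boolean_lattice n)) \<le> 2 * real n + 3"
    using poset_Ramsey_3[of n] by linarith
  ultimately show ?thesis by linarith
qed

end
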